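(* Let $\lambda=(\lambda_1\ge\lambda_2\ge\cdots\ge\lambda_\ell>0)$ be a partition of $m-1$, and let $U_\lambda\subset\mathfrak{gl}_m$ be the $m$-dimensional abelian Lie algebra associated to the flag induced by $\lambda$, i.e. the span of the identity matrix and the matrix units $E_{i,\,m+1-j}$ for $1\le i\le\ell$, $1\le j\le\lambda_i$. Then $U_\lambda$ belongs to $Red(m)$, the closure of the diagonalizable algebras. That is, the associated tensor $T_\lambda\in\mathbb{C}^m\otimes\mathbb{C}^m\otimes\mathbb{C}^m$ with $T_\lambda(A^* )=U_\lambda$ has border rank $m$.
   Context: All vector spaces are over $\mathbb{C}$. $Red(m)$ (the variety of reductions) is the Zariski closure in the Grassmannian $G(m,\mathfrak{gl}_m)$ of the set of $m$-dimensional subspaces having a simultaneously diagonalizable basis (equivalently, after quotienting by the identity, the closure in $G(m-1,\mathfrak{sl}_m)$ of the set of $(m-1)$-dimensional subspaces with a simultaneously diagonalizable basis). The space $U_\lambda$ is described by placing $x_1$ on the diagonal of an $m\times m$ matrix and placing the Young diagram of $\lambda$, reflected across a vertical line and filled with the distinct variables $x_2,\dots,x_m$, in the upper right corner. For example $\lambda=(4,2,1)$, $m=8$: row 1 has $x_2,x_3,x_4,x_5$ in columns 5–8, row 2 has $x_6,x_7$ in columns 7–8, row 3 has $x_8$ in column 8, and $x_1$ is on the diagonal. A tensor $T\in A\otimes B\otimes C$ is viewed as a linear map $T:A^*\to B\otimes C$ and is determined up to isomorphism by the space $T(A^* )$ (here of dimension $m=\dim A$). The border rank of $T$ is the least $r$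 such that $T$ is a limit of sums of $r$ tensors $a\otimes b\otimes c$. *)

theory Defs
  imports "HOL-Analysis.Analysis"
begin

section \<open>The complex vector space of matrices\<close>

text \<open>
  The library's \<open>span\<close>, \<open>dim\<close>, ... on \<open>complex^'n^'m\<close> refer to the real scalar
  multiplication; the complex notions are obtained by interpreting \<^locale>\<open>vector_space\<close>.
\<close>

definition cscale :: "complex \<Rightarrow> complex^'n^'m \<Rightarrow> complex^'n^'m"  (infixr "*\<^sub>\<complex>" 75)
  where "c *\<^sub>\<complex> A = (\<chi> i j. c * A $ i $ j)"

global_interpretation cmat: vector_space "cscale :: complex \<Rightarrow> complex^'n^'m \<Rightarrow> complex^'n^'m"
  by unfold_locales (simp_all add: cscale_def vec_eq_iff algebra_simps)

text \<open>A basis of a \<open>CARD('k)\<close>-dimensional subspace, as a family indexed by \<open>'k\<close>.\<close>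

definition is_basis_family :: "('k::finite \<Rightarrow> complex^'n^'m) \<Rightarrow> (complex^'n^'m) set \<Rightarrow> bool"
  where "is_basis_family A W \<longleftrightarrow>
    inj A \<and> \<not> cmat.dependent (range A) \<and> cmat.span (range A) = W"


section \<open>The Grassmannian and its Zariski topology\<close>

definition grassmannian :: "nat \<Rightarrow> (complex^'n^'m) set set"
  where "grassmannian k = {W. cmat.subspace W \<and> cmat.dim W = k}"

text \<open>
  Homogeneous polynomials of a given degree in variables indexed by \<open>'i\<close>, as polynomial
  functions (over the infinite field of complex numbers this loses nothing).
\<close>

inductive homogeneous_poly :: "nat \<Rightarrow> (('i \<Rightarrow> complex) \<Rightarrow> complex) \<Rightarrow> bool"
  where
    const: "homogeneous_poly 0 (\<lambda>x. c)"
  | var: "homogeneous_poly 1 (\<lambda>x. x i)"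
  | add: "homogeneous_poly d f \<Longrightarrow> homogeneous_poly d g \<Longrightarrow> homogeneous_poly d (\<lambda>x. f x + g x)"
  | mult: "homogeneous_poly d f \<Longrightarrow> homogeneous_poly e g \<Longrightarrow>
      homogeneous_poly (d + e) (\<lambda>x. f x * g x)"

text \<open>
  The Pluecker coordinates of the span of \<open>A\<close>: the maximal minors of the matrix with rows
  \<open>A s\<close> and columns indexed by matrix positions.  They are indexed by all families of
  positions rather than by sets of positions; the additional coordinates are zero or
  agree with the usual ones up to sign.
\<close>

definition pluecker :: "('k::finite \<Rightarrow> complex^'n^'m) \<Rightarrow> ('k \<Rightarrow> 'm \<times> 'n) \<Rightarrow> complex"
  where "pluecker A p = det (\<chi> s t. A s $ fst (p t) $ snd (p t))"

text \<open>
  Another basis multiplies all Pluecker coordinates by the same nonzero scalar, so for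
  homogeneous \<open>F\<close> the following does not depend on the basis.
\<close>

definition vanishes_at ::
    "((('k::finite \<Rightarrow> 'm \<times> 'n) \<Rightarrow> complex) \<Rightarrow> complex) \<Rightarrow> (complex^'n^'m) set \<Rightarrow> bool"
  where "vanishes_at F W \<longleftrightarrow> (\<forall>A. is_basis_family A W \<longrightarrow> F (pluecker A) = 0)"

text \<open>
  The closed sets of \<open>G(k, V)\<close> for \<open>k = CARD('k)\<close>: the common zero loci of homogeneous
  polynomials in the Pluecker coordinates.
\<close>

definition zariski_closed_in_grassmannian :: "'k::finite itself \<Rightarrow> (complex^'n^'m) set set \<Rightarrow> bool"
  where "zariski_closed_in_grassmannian _ Z \<longleftrightarrow>
    (\<exists>\<F> :: ((('k \<Rightarrow> 'm \<times> 'n) \<Rightarrow> complex) \<Rightarrow> complex) set.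
      (\<forall>F\<in>\<F>. \<exists>d. homogeneous_poly d F) \<and>
      Z = {W \<in> grassmannian CARD('k). \<forall>F\<in>\<F>. vanishes_at F W})"


section \<open>The variety of reductions\<close>

definition diagonal_matrix :: "complex^'n^'n \<Rightarrow> bool"
  where "diagonal_matrix D \<longleftrightarrow> (\<forall>i j. i \<noteq> j \<longrightarrow> D $ i $ j = 0)"

definition simultaneously_diagonalizable :: "(complex^'n^'n) set \<Rightarrow> bool"
  where "simultaneously_diagonalizable S \<longleftrightarrow>
    (\<exists>P :: complex^'n^'n. invertible P \<and> (\<forall>A\<in>S. diagonal_matrix (matrix_inv P ** A ** P)))"

text \<open>Here \<open>m = CARD('n)\<close>, both for the matrix size and for the dimension of the subspaces.\<close>

definition diagonalizable_subspaces :: "(complex^'n^'n) set set"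
  where "diagonalizable_subspaces = {W \<in> grassmannian CARD('n).
    \<exists>A :: 'n \<Rightarrow> complex^'n^'n. is_basis_family A W \<and> simultaneously_diagonalizable (range A)}"

definition Red :: "(complex^'n^'n) set set"
  where "Red = zariski_closed_in_grassmannian TYPE('n) hull diagonalizable_subspaces"


section \<open>Tensors and border rank\<close>

text \<open>
  A tensor in \<open>A \<otimes> B \<otimes> C\<close> is given by its coordinates \<open>T $ i $ j $ k\<close>, with \<open>i\<close>, \<open>j\<close>, \<open>k\<close>
  referring to \<open>A\<close>, \<open>B\<close>, \<open>C\<close>; a matrix stands for an element of \<open>B \<otimes> C\<close>.
  Elements of the dual of \<open>A\<close> are given by their coordinates in the dual basis.
\<close>

definition flattening :: "complex^'c^'b^'a \<Rightarrow> complex^'a \<Rightarrow> complex^'c^'b"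
  where "flattening T \<alpha> = (\<Sum>i\<in>UNIV. (\<alpha> $ i) *\<^sub>\<complex> (T $ i))"

definition simple_tensor :: "complex^'a \<Rightarrow> complex^'b \<Rightarrow> complex^'c \<Rightarrow> complex^'c^'b^'a"
  where "simple_tensor a b c = (\<chi> i j k. a $ i * b $ j * c $ k)"

definition sums_of_simple_tensors :: "nat \<Rightarrow> (complex^'c^'b^'a) set"
  where "sums_of_simple_tensors r = {\<Sum>s<r. simple_tensor (a s) (b s) (c s) | a b c. True}"

definition border_rank :: "complex^'c^'b^'a \<Rightarrow> nat"
  where "border_rank T =
    (LEAST r. \<exists>X. (\<forall>n. X n \<in> sums_of_simple_tensors r) \<and> X \<longlonglongrightarrow> T)"


section \<open>Partitions and the spaces they define\<close>

text \<open>Lists are indexed from 0, so the part written \<open>\<lambda>\<^sub>i\<close> is \<open>l ! (i - 1)\<close>.\<close>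

definition is_partition :: "nat list \<Rightarrow> nat \<Rightarrow> bool"
  where "is_partition l n \<longleftrightarrow>
    sorted_wrt (\<ge>) l \<and> (\<forall>x\<in>set l. x > 0) \<and> sum_list l = n"

definition matrix_unit :: "'m \<Rightarrow> 'n \<Rightarrow> complex^'n^'m"
  where "matrix_unit p q = (\<chi> i j. if i = p \<and> j = q then 1 else 0)"

text \<open>
  The index type \<open>'n\<close> carries no order; \<open>idx\<close> is a numbering of it by \<open>1, ..., m\<close>,
  i.e. row (and column) number \<open>i\<close> is \<open>idx i\<close>.
\<close>

definition U_partition :: "(nat \<Rightarrow> 'n) \<Rightarrow> nat list \<Rightarrow> (complex^'n^'n) set"
  where "U_partition idx l = cmat.span (insert (mat 1)
    {matrix_unit (idx i) (idx (CARD('n) + 1 - j)) | i j.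
      i \<in> {1..length l} \<and> j \<in> {1..l ! (i - 1)}})"

end

theory Submission
  imports Defs
begin

text \<open>
  The idempotents \<open>v\<^sub>k w\<^sub>k\<^sup>T\<close> of a pair of dual bases \<open>v\<close>, \<open>w\<close> span a diagonalizable space containing the
  identity.  We let the bases depend on \<open>t\<close> so that a multiple of each of \<open>m - 1\<close> of the idempotents tends
  to a matrix unit of the Young diagram.  The hook formed by the first row and the first column of the
  diagram has as many cells as there are rows and columns meeting the diagram, minus one; so the cells
  outside the hook are as many as the remaining indices.  Giving such a cell \<open>(i, c)\<close> an index \<open>f\<close> of
  its own, we use \<open>(t e\<^sub>f + e\<^sub>i) (t e\<^sub>f + e\<^sub>c)\<^sup>T\<close>.  The vectors for the hook cells are perturbed by terms
  vanishing at \<open>t = 0\<close> to restore duality.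

  Such a degeneration also writes the tensor as a limit of sums of \<open>m\<close> simple tensors.  Fewer do not
  suffice: contracting them with the functional that maps to the identity matrix gives singular matrices,
  which do not converge to the identity.
\<close>

section \<open>Limits of diagonalizable spaces\<close>

lemma cscale_nth [simp]: "(c *\<^sub>\<complex> A) $ i $ j = c * A $ i $ j"
  by (simp add: cscale_def)

text \<open>Independence as a family also gives injectivity: two equal members would be related by
  the coefficients \<open>1\<close> and \<open>-1\<close>.\<close>

lemma is_basis_familyI:
  fixes A :: "'k::finite \<Rightarrow> complex^'n^'m"
  assumes indep: "\<And>x. (\<Sum>k\<in>UNIV. x k *\<^sub>\<complex> A k) = 0 \<Longrightarrow> x = (\<lambda>k. 0)"
  shows "is_basis_family A (cmat.span (range A))"
proof -
  have "inj A"
  proof (rule injI, rule ccontr)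
    fix a b assume eq: "A a = A b" and ne: "a \<noteq> b"
    define x :: "'k \<Rightarrow> complex" where "x = (\<lambda>k. if k = a then 1 else if k = b then -1 else 0)"
    have x: "x k *\<^sub>\<complex> A k = (if k = a then A a else 0) + (if k = b then - A b else 0)" for k
      using ne by (auto simp: x_def)
    have "(\<Sum>k\<in>UNIV. x k *\<^sub>\<complex> A k) = 0"
      unfolding x sum.distrib by (simp add: eq)
    from fun_cong[OF indep[OF this], of a] show False by (simp add: x_def)
  qed
  moreover have "\<not> cmat.dependent (range A)"
  proof
    assume "cmat.dependent (range A)"
    then obtain u where u: "\<exists>v\<in>range A. u v \<noteq> 0" "(\<Sum>v\<in>range A. u v *\<^sub>\<complex> v) = 0"
      by (auto simp: cmat.dependent_finite)
    have "(\<Sum>k\<in>UNIV. u (A k) *\<^sub>\<complex> A k) = 0"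
      using u(2) \<open>inj A\<close> by (simp add: sum.reindex)
    from fun_cong[OF indep[OF this]] u(1) show False by auto
  qed
  ultimately show ?thesis by (simp add: is_basis_family_def)
qed

lemma basis_family_in_grassmannian:
  fixes A :: "'k::finite \<Rightarrow> complex^'n^'m"
  assumes "is_basis_family A W"
  shows "W \<in> grassmannian CARD('k)"
proof -
  have "cmat.dim (cmat.span (range A)) = card (range A)"
    using assms by (intro cmat.dim_span_eq_card_independent) (simp add: is_basis_family_def)
  then show ?thesis
    using assms cmat.subspace_span by (auto simp: is_basis_family_def grassmannian_def card_image)
qed

lemma in_span_range:
  fixes B :: "'k::finite \<Rightarrow> complex^'n^'m"
  assumes "M \<in> cmat.span (range B)"
  shows "\<exists>x. M = (\<Sum>k\<in>UNIV. x k *\<^sub>\<complex> B k)"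
  using assms
proof (induction rule: cmat.span_induct_alt)
  case base
  show ?case by (rule exI[of _ "\<lambda>_. 0"]) simp
next
  case (step c N M)
  then obtain x k where x: "M = (\<Sum>k\<in>UNIV. x k *\<^sub>\<complex> B k)" and k: "N = B k" by auto
  have "c *\<^sub>\<complex> N + M = (\<Sum>j\<in>UNIV. (x j + (if j = k then c else 0)) *\<^sub>\<complex> B j)"
    by (simp add: cmat.scale_left_distrib sum.distrib x k if_distrib[of "\<lambda>c. c *\<^sub>\<complex> _"] cong: if_cong)
  then show ?case by (intro exI[of _ "\<lambda>j. x j + (if j = k then c else 0)"])
qed

lemma range_flattening:
  fixes T :: "complex^'c^'b^'a"
  shows "range (flattening T) = cmat.span (range (($) T))"
proof
  show "range (flattening T) \<subseteq> cmat.span (range (($) T))"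
    unfolding flattening_def
    by (intro image_subsetI cmat.span_sum cmat.span_scale cmat.span_base rangeI)
  show "cmat.span (range (($) T)) \<subseteq> range (flattening T)"
  proof
    fix M assume "M \<in> cmat.span (range (($) T))"
    then obtain x where "M = (\<Sum>k\<in>UNIV. x k *\<^sub>\<complex> T $ k)" using in_span_range by blast
    then have "M = flattening T (\<chi> k. x k)" by (simp add: flattening_def)
    then show "M \<in> range (flattening T)" by blast
  qed
qed

section \<open>Pluecker coordinates under limits and change of basis\<close>

lemma homogeneous_poly_scale:
  "homogeneous_poly d F \<Longrightarrow> F (\<lambda>i. c * x i) = c ^ d * F x"
  by (induction rule: homogeneous_poly.induct) (auto simp: algebra_simps power_add)

lemma homogeneous_poly_tendsto:
  assumes "homogeneous_poly d F" and "\<And>i. (\<lambda>n. x n i) \<longlonglongrightarrow> y i"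
  shows "(\<lambda>n. F (x n)) \<longlonglongrightarrow> F y"
  using assms by (induction rule: homogeneous_poly.induct) (auto intro!: tendsto_intros)

lemma tendsto_det:
  fixes M :: "nat \<Rightarrow> complex^'k^'k"
  assumes "\<And>i j. (\<lambda>n. M n $ i $ j) \<longlonglongrightarrow> N $ i $ j"
  shows "(\<lambda>n. det (M n)) \<longlonglongrightarrow> det N"
  unfolding det_def by (intro tendsto_intros assms)

text \<open>For every \<open>p\<close> the matrix of selected entries is \<open>G\<close> times that
  of \<open>B\<close>, so multiplicativity of \<open>det\<close> gives one factor common to all
  coordinates.\<close>

lemma pluecker_linear_combination:
  fixes B :: "'k::finite \<Rightarrow> complex^'n^'m"
  shows "pluecker (\<lambda>s. \<Sum>u\<in>UNIV. G s u *\<^sub>\<complex> B u) = (\<lambda>p. det (\<chi> s u. G s u) * pluecker B p)"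
proof
  fix p :: "'k \<Rightarrow> 'm \<times> 'n"
  have "(\<chi> s t. (\<Sum>u\<in>UNIV. G s u *\<^sub>\<complex> B u) $ fst (p t) $ snd (p t)) =
      (\<chi> s u. G s u) ** (\<chi> s t. B s $ fst (p t) $ snd (p t))"
    by (simp add: matrix_matrix_mult_def vec_eq_iff)
  then show "pluecker (\<lambda>s. \<Sum>u\<in>UNIV. G s u *\<^sub>\<complex> B u) p = det (\<chi> s u. G s u) * pluecker B p"
    by (simp add: pluecker_def det_mul)
qed

lemma tendsto_pluecker:
  assumes "\<And>k. (\<lambda>n. A n k) \<longlonglongrightarrow> B k"
  shows "(\<lambda>n. pluecker (A n) p) \<longlonglongrightarrow> pluecker B p"
  unfolding pluecker_def by (rule tendsto_det) (auto intro!: tendsto_vec_nth assms)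

text \<open>
  Two bases of the limit space have proportional Pluecker coordinates, so homogeneity reduces
  the vanishing at an arbitrary basis to the basis that is a limit.
\<close>

lemma limit_in_zariski_closed:
  fixes A :: "nat \<Rightarrow> 'k::finite \<Rightarrow> complex^'n^'m"
  assumes closed: "zariski_closed_in_grassmannian TYPE('k) Z"
    and A: "\<And>n. is_basis_family (A n) (W n)" and W: "\<And>n. W n \<in> Z"
    and B: "is_basis_family B U" and lim: "\<And>k. (\<lambda>n. A n k) \<longlonglongrightarrow> B k"
  shows "U \<in> Z"
proof -
  from closed obtain \<F> :: "((('k \<Rightarrow> 'm \<times> 'n) \<Rightarrow> complex) \<Rightarrow> complex) set" where
    hom: "\<And>F. F \<in> \<F> \<Longrightarrow> \<exists>d. homogeneous_poly d F" and
    Z: "Z = {W \<in> grassmannian CARD('k). \<forall>F\<in>\<F>. vanishes_at F W}"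
    by (auto simp: zariski_closed_in_grassmannian_def)
  have "F (pluecker B') = 0" if F: "F \<in> \<F>" and B': "is_basis_family B' U" for F B'
  proof -
    obtain d where d: "homogeneous_poly d F" using hom F by blast
    have "(\<lambda>n. F (pluecker (A n))) \<longlonglongrightarrow> F (pluecker B)"
      by (intro homogeneous_poly_tendsto[OF d] tendsto_pluecker lim)
    moreover have "F (pluecker (A n)) = 0" for n
      using W[of n] A F by (auto simp: Z vanishes_at_def)
    ultimately have zero: "F (pluecker B) = 0"
      by (simp add: LIMSEQ_const_iff)
    have "B' s \<in> cmat.span (range B)" for s
      using B B' cmat.span_base[of "B' s" "range B'"] by (auto simp: is_basis_family_def)
    then have "\<forall>s. \<exists>x. B' s = (\<Sum>u\<in>UNIV. x u *\<^sub>\<complex> B u)" using in_span_range by blast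
    then obtain G where "\<And>s. B' s = (\<Sum>u\<in>UNIV. G s u *\<^sub>\<complex> B u)" by metis
    then have "B' = (\<lambda>s. \<Sum>u\<in>UNIV. G s u *\<^sub>\<complex> B u)" by blast
    then show ?thesis
      using homogeneous_poly_scale[OF d] zero by (simp add: pluecker_linear_combination)
  qed
  then show ?thesis
    using basis_family_in_grassmannian[OF B] by (auto simp: Z vanishes_at_def)
qed

section \<open>The lower bound for border rank\<close>

lemma flattening_sum_simple_tensor:
  "flattening (\<Sum>s\<in>S. simple_tensor (a s) (b s) (c s)) \<alpha> =
    (\<chi> j k. \<Sum>s\<in>S. (\<Sum>i\<in>UNIV. \<alpha> $ i * a s $ i) * b s $ j * c s $ k)"
proof -
  have "(\<Sum>i\<in>UNIV. \<alpha> $ i * (\<Sum>s\<in>S. a s $ i * b s $ j * c s $ k)) =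
      (\<Sum>s\<in>S. (\<Sum>i\<in>UNIV. \<alpha> $ i * a s $ i) * b s $ j * c s $ k)" for j k
    by (simp add: sum_distrib_left sum_distrib_right mult.assoc sum.swap[of _ S])
  then show ?thesis
    by (simp add: flattening_def simple_tensor_def vec_eq_iff)
qed

text \<open>The sum factors through a space of dimension \<open>r\<close>; when the factorization is
  padded to square size, the left factor has a zero column.\<close>

lemma det_sum_few_rank_one:
  fixes b c :: "nat \<Rightarrow> complex^'n"
  assumes "r < CARD('n)"
  shows "det (\<chi> j k. \<Sum>s<r. x s * b s $ j * c s $ k) = 0"
proof -
  obtain h :: "'n \<Rightarrow> nat" where h: "bij_betw h UNIV {0..<CARD('n)}"
    using ex_bij_betw_finite_nat[of "UNIV :: 'n set"] by auto
  \<comment> \<open>\<open>q\<close> carries the number \<open>r\<close>, the first one beyond the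
    summands; its column in \<open>M\<close> vanishes.\<close>
  then obtain q where q: "h q = r" using assms bij_betw_imp_surj_on[OF h]
    by (metis atLeastLessThan_iff imageE zero_le)
  define M N :: "complex^'n^'n"
    where "M = (\<chi> j t. if h t < r then x (h t) * b (h t) $ j else 0)" and "N = (\<chi> t k. c (h t) $ k)"
  have "(\<Sum>s<r. x s * b s $ j * c s $ k) = (M ** N) $ j $ k" for j k
  proof -
    have "(\<Sum>s<r. x s * b s $ j * c s $ k) =
        (\<Sum>s\<in>{0..<CARD('n)}. (if s < r then x s * b s $ j else 0) * c s $ k)"
      using assms by (intro sum.mono_neutral_cong_left) auto
    also have "\<dots> = (M ** N) $ j $ k"
      by (simp add: M_def N_def matrix_matrix_mult_def flip: sum.reindex_bij_betw[OF h])
    finally show ?thesis .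
  qed
  then have "(\<chi> j k. \<Sum>s<r. x s * b s $ j * c s $ k) = M ** N" by (simp add: vec_eq_iff)
  moreover have "det M = 0"
    by (rule det_zero_column(2)[of q]) (simp add: column_def M_def q vec_eq_iff)
  ultimately show ?thesis by (simp add: det_mul)
qed

lemma border_rank_lower_bound:
  fixes T :: "complex^'n^'n^'a"
  assumes one: "mat 1 \<in> range (flattening T)"
    and X: "\<And>n. X n \<in> sums_of_simple_tensors r" and lim: "X \<longlonglongrightarrow> T"
  shows "CARD('n) \<le> r"
proof (rule ccontr)
  assume "\<not> CARD('n) \<le> r"
  from one obtain \<alpha> where \<alpha>: "flattening T \<alpha> = mat 1" by force
  have "det (flattening (X n) \<alpha>) = 0" for n
    using X[of n] \<open>\<not> CARD('n) \<le> r\<close>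
    by (auto simp: sums_of_simple_tensors_def flattening_sum_simple_tensor det_sum_few_rank_one)
  moreover have "(\<lambda>n. det (flattening (X n) \<alpha>)) \<longlonglongrightarrow> det (flattening T \<alpha>)"
    by (rule tendsto_det) (simp add: flattening_def, intro tendsto_intros lim)
  ultimately show False by (simp add: \<alpha> LIMSEQ_const_iff)
qed

section \<open>Families of the form \<open>P ** diag d ** Q\<close>\<close>

definition diag :: "('n \<Rightarrow> complex) \<Rightarrow> complex^'n^'n"
  where "diag d = (\<chi> i j. if i = j then d i else 0)"

lemma diag_nth [simp]: "diag d $ i $ j = (if i = j then d i else 0)"
  by (simp add: diag_def)

text \<open>The expansion into rank-one matrices, column \<open>s\<close> of \<open>P\<close> times
  row \<open>s\<close> of \<open>Q\<close>, from which simple tensors are later obtained.\<close>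

lemma conj_diag_nth:
  "(P ** diag d ** Q) $ i $ j = (\<Sum>s\<in>UNIV. d s * P $ i $ s * Q $ s $ j)"
  by (simp add: matrix_matrix_mult_def if_distrib cong: if_cong) (simp add: mult.commute mult.left_commute)

lemma sum_conj_diag:
  "(\<Sum>k\<in>K. x k *\<^sub>\<complex> (P ** diag (d k) ** Q)) = P ** diag (\<lambda>s. \<Sum>k\<in>K. x k * d k s) ** Q"
proof -
  have "(\<Sum>k\<in>K. x k * (\<Sum>s\<in>UNIV. d k s * P $ i $ s * Q $ s $ j)) =
      (\<Sum>s\<in>UNIV. (\<Sum>k\<in>K. x k * d k s) * P $ i $ s * Q $ s $ j)" for i j
    by (simp add: sum_distrib_left sum_distrib_right mult.assoc sum.swap[of _ K])
  then show ?thesis by (simp add: vec_eq_iff conj_diag_nth)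
qed

lemma conj_conj_inverse:
  fixes P Q D :: "complex^'n^'n"
  assumes "P ** Q = mat 1"
  shows "Q ** (P ** D ** Q) ** P = D"
proof -
  have "Q ** P = mat 1" using assms matrix_left_right_inverse by blast
  moreover have "Q ** (P ** D ** Q) ** P = (Q ** P) ** D ** (Q ** P)" by (simp add: matrix_mul_assoc)
  ultimately show ?thesis by simp
qed

lemma matrix_inv_unique:
  fixes P Q :: "complex^'n^'n"
  assumes "P ** Q = mat 1"
  shows "matrix_inv P = Q"
proof -
  have "\<exists>Q'. P ** Q' = mat 1 \<and> Q' ** P = mat 1"
    using assms matrix_left_right_inverse by blast
  from someI_ex[OF this] have "matrix_inv P ** P = mat 1" unfolding matrix_inv_def by (rule conjunct2)
  then have "matrix_inv P ** P ** Q = Q" by simp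
  then show ?thesis by (simp add: assms flip: matrix_mul_assoc)
qed

text \<open>Conjugation by \<open>P\<close> is linear and injective, so independence is a matter of
  the diagonals alone.\<close>

lemma conj_diag_basis_family:
  fixes P Q :: "complex^'n^'n"
  assumes inv: "P ** Q = mat 1" and A: "\<And>k. A k = P ** diag (d k) ** Q"
    and indep: "\<And>x :: 'k::finite \<Rightarrow> complex. (\<And>s. (\<Sum>k\<in>UNIV. x k * d k s) = 0) \<Longrightarrow> x = (\<lambda>k. 0)"
  shows "is_basis_family A (cmat.span (range A))"
proof (rule is_basis_familyI)
  fix x assume "(\<Sum>k\<in>UNIV. x k *\<^sub>\<complex> A k) = 0"
  then have "P ** diag (\<lambda>s. \<Sum>k\<in>UNIV. x k * d k s) ** Q = 0"
    by (simp add: A sum_conj_diag)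
  then have "diag (\<lambda>s. \<Sum>k\<in>UNIV. x k * d k s) = Q ** 0 ** P"
    using conj_conj_inverse[OF inv] by metis
  also have "\<dots> = 0" by (simp add: matrix_matrix_mult_def vec_eq_iff)
  finally have "diag (\<lambda>s. \<Sum>k\<in>UNIV. x k * d k s) = 0" .
  then have "(\<Sum>k\<in>UNIV. x k * d k s) = 0" for s
    by (metis diag_nth zero_index)
  then show "x = (\<lambda>k. 0)" by (rule indep)
qed

lemma conj_diag_in_diagonalizable:
  fixes P Q :: "complex^'n^'n" and A :: "'n \<Rightarrow> complex^'n^'n"
  assumes inv: "P ** Q = mat 1" and A: "\<And>k. A k = P ** diag (d k) ** Q"
    and basis: "is_basis_family A W"
  shows "W \<in> diagonalizable_subspaces"
proof -
  have "invertible P" using inv invertible_right_inverse by blast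
  moreover have "diagonal_matrix (matrix_inv P ** A k ** P)" for k
    by (simp add: A matrix_inv_unique[OF inv] conj_conj_inverse[OF inv] diagonal_matrix_def)
  ultimately show ?thesis
    using basis basis_family_in_grassmannian[OF basis]
    unfolding diagonalizable_subspaces_def simultaneously_diagonalizable_def by fast
qed

text \<open>All slices share the same rank-one matrices; collecting their coefficients for a fixed
  \<open>s\<close> into a vector gives one simple tensor per index \<open>s\<close>.\<close>

lemma conj_diag_tensor_rank:
  fixes P Q :: "complex^'n^'n" and T :: "complex^'n^'n^'a"
  assumes "\<And>k. T $ k = P ** diag (d k) ** Q"
  shows "T \<in> sums_of_simple_tensors CARD('n)"
proof -
  obtain h :: "nat \<Rightarrow> 'n" where h: "bij_betw h {0..<CARD('n)} UNIV"
    using ex_bij_betw_nat_finite[of "UNIV :: 'n set"] by auto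
  have "T = (\<Sum>s\<in>UNIV. simple_tensor (\<chi> k. d k s) (\<chi> i. P $ i $ s) (Q $ s))"
    by (simp add: vec_eq_iff assms conj_diag_nth simple_tensor_def)
  also have "\<dots> = (\<Sum>s<CARD('n).
      simple_tensor (\<chi> k. d k (h s)) (\<chi> i. P $ i $ h s) (Q $ h s))"
    by (simp add: lessThan_atLeast0 sum.reindex_bij_betw[OF h,
      of "\<lambda>s. simple_tensor (\<chi> k. d k s) (\<chi> i. P $ i $ s) (Q $ s)"])
  finally have eq: "T = (\<Sum>s<CARD('n).
      simple_tensor (\<chi> k. d k (h s)) (\<chi> i. P $ i $ h s) (Q $ h s))" .
  show ?thesis unfolding sums_of_simple_tensors_def
    by (rule CollectI, rule exI[of _ "\<lambda>s. \<chi> k. d k (h s)"],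
      rule exI[of _ "\<lambda>s. \<chi> i. P $ i $ h s"], rule exI[of _ "\<lambda>s. Q $ h s"]) (simp add: eq)
qed

lemma limit_of_conj_diag:
  fixes A :: "nat \<Rightarrow> 'n \<Rightarrow> complex^'n^'n" and P Q :: "nat \<Rightarrow> complex^'n^'n"
  assumes inv: "\<And>n. P n ** Q n = mat 1" and A: "\<And>n k. A n k = P n ** diag (d n k) ** Q n"
    and indep: "\<And>n x. (\<And>s. (\<Sum>k\<in>UNIV. x k * d n k s) = 0) \<Longrightarrow> x = (\<lambda>k. 0)"
    and B: "is_basis_family B U" and lim: "\<And>k. (\<lambda>n. A n k) \<longlonglongrightarrow> B k" and one: "mat 1 \<in> U"
  shows limit_in_Red: "U \<in> Red"
    and limit_border_rank:
      "\<And>T :: complex^'n^'n^'n. range (flattening T) = U \<Longrightarrow> border_rank T = CARD('n)"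
proof -
  have basis: "is_basis_family (A n) (cmat.span (range (A n)))" for n
    using conj_diag_basis_family[OF inv A indep] .
  show "U \<in> Red"
    \<comment> \<open>The hull is the intersection of all closed supersets, so it suffices to place
      \<open>U\<close> in each of them.\<close>
    unfolding Red_def hull_def
  proof safe
    fix Z :: "(complex^'n^'n) set set"
    assume Z: "zariski_closed_in_grassmannian TYPE('n) Z" "diagonalizable_subspaces \<subseteq> Z"
    have "cmat.span (range (A n)) \<in> Z" for n
      using conj_diag_in_diagonalizable[OF inv A basis] Z(2) by blast
    from limit_in_zariski_closed[OF Z(1) basis this B lim] show "U \<in> Z" .
  qed
next
  fix T :: "complex^'n^'n^'n"
  assume T: "range (flattening T) = U"
  have "T $ k \<in> cmat.span (range B)" for k
    using B T cmat.span_base[of "T $ k" "range (($) T)"]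
    by (auto simp: is_basis_family_def range_flattening)
  then have "\<forall>k. \<exists>x. T $ k = (\<Sum>u\<in>UNIV. x u *\<^sub>\<complex> B u)" using in_span_range by blast
  then obtain G where G: "\<And>k. T $ k = (\<Sum>u\<in>UNIV. G k u *\<^sub>\<complex> B u)" by metis
  \<comment> \<open>The coefficients \<open>G\<close> of the slices of \<open>T\<close> in the limit
    basis are kept fixed while the basis is replaced by its approximations.\<close>
  define X :: "nat \<Rightarrow> complex^'n^'n^'n" where "X n = (\<chi> k. \<Sum>u\<in>UNIV. G k u *\<^sub>\<complex> A n u)" for n
  have "X n $ k = P n ** diag (\<lambda>s. \<Sum>u\<in>UNIV. G k u * d n u s) ** Q n" for n k
    by (simp add: X_def A sum_conj_diag)
  then have X: "\<And>n. X n \<in> sums_of_simple_tensors CARD('n)" by (rule conj_diag_tensor_rank)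
  have "(\<lambda>n. X n $ k $ i $ j) \<longlonglongrightarrow> T $ k $ i $ j" for k i j
    unfolding X_def G by (simp, intro tendsto_intros lim)
  then have "X \<longlonglongrightarrow> T" by (intro vec_tendstoI)
  then show "border_rank T = CARD('n)"
    unfolding border_rank_def using X border_rank_lower_bound[of T] T one
    by (intro Least_equality) blast+
qed


section \<open>The degeneration\<close>

text \<open>
  \<open>R\<close> and \<open>C\<close> are the rows and the columns met by the diagram, \<open>r0\<close> is the first row and \<open>c0\<close> the first
  column of the diagram (the last one of the matrix).  Every index \<open>k \<noteq> r0\<close> labels one cell
  \<open>(\<rho> k, \<kappa> k)\<close>: rows and columns label the cells of the hook \<open>{r0} \<times> C \<union> R \<times> {c0}\<close>, all other
  indices label the remaining cells.
\<close>

locale cell_labelling =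
  fixes R C :: "'n::finite set" and r0 c0 :: 'n and \<rho> \<kappa> :: "'n \<Rightarrow> 'n"
  assumes disjoint: "R \<inter> C = {}" and r0: "r0 \<in> R" and c0: "c0 \<in> C"
    and label_row: "\<And>k. k \<in> R - {r0} \<Longrightarrow> \<rho> k = k \<and> \<kappa> k = c0"
    and label_col: "\<And>k. k \<in> C \<Longrightarrow> \<rho> k = r0 \<and> \<kappa> k = k"
    and label_inner: "\<And>k. k \<notin> R \<union> C \<Longrightarrow> \<rho> k \<in> R - {r0} \<and> \<kappa> k \<in> C - {c0}"
    and inj_inner: "inj_on (\<lambda>k. (\<rho> k, \<kappa> k)) (- (R \<union> C))"
begin

definition F :: "'n set" where "F = - (R \<union> C)"

text \<open>
  The vectors are rescaled so as to be polynomial in \<open>t\<close>: \<open>row_vec t k\<close> pairs to \<open>weight t k\<close> with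
  \<open>col_vec t k\<close> and to zero with the other \<open>col_vec t k'\<close>.  For \<open>k \<noteq> r0\<close> they become the coordinate
  vectors number \<open>\<kappa> k\<close> and \<open>\<rho> k\<close> at \<open>t = 0\<close>.
\<close>

definition col_vec :: "complex \<Rightarrow> 'n \<Rightarrow> 'n \<Rightarrow> complex" where
  "col_vec t k a =
    (if k \<in> R then of_bool (a = k)
     else if k = c0 then t^4 * of_bool (a = c0) + of_bool (a = r0) - t * of_bool (a \<in> R - {r0})
     else if k \<in> C then t^3 * of_bool (a = k) + of_bool (a = r0)
       - t * of_nat (card {f \<in> F. \<rho> f = a \<and> \<kappa> f = k}) - t^2 * of_bool (a \<in> F \<and> \<kappa> a = k)
     else t * of_bool (a = k) + of_bool (a = \<rho> k))"

definition row_vec :: "complex \<Rightarrow> 'n \<Rightarrow> 'n \<Rightarrow> complex" where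
  "row_vec t k b =
    (if k \<in> C then of_bool (b = k)
     else if k = r0 then t^4 * of_bool (b = r0) - t * of_bool (b \<in> C - {c0}) - of_bool (b = c0)
     else if k \<in> R then t^3 * of_bool (b = k) + of_bool (b = c0) - t^2 * of_bool (b \<in> F \<and> \<rho> b = k)
     else t * of_bool (b = k) + of_bool (b = \<kappa> k))"

text \<open>The exponents are set by cancellation. A vector of \<open>F\<close> has entries
  \<open>t\<close> and \<open>1\<close>, giving \<open>t^2\<close>. Hook vectors need
  \<open>t^3\<close> to cancel \<open>t^2 * t\<close>, and those of \<open>r0\<close> and
  \<open>c0\<close> need \<open>t^4\<close> to cancel \<open>t * t^3\<close>.\<close>

definition weight :: "complex \<Rightarrow> 'n \<Rightarrow> complex" where
  "weight t k = (if k \<in> F then t^2 else if k = r0 \<or> k = c0 then t^4 else t^3)"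

section \<open>Duality of the deformed vectors\<close>

lemma weight_nonzero: "t \<noteq> 0 \<Longrightarrow> weight t k \<noteq> 0"
  by (simp add: weight_def)

lemma R_iff: "x \<in> R \<longleftrightarrow> x \<notin> C \<and> x \<notin> F"
  using disjoint by (auto simp: F_def)

lemma C_not_F: "x \<in> C \<Longrightarrow> x \<notin> F"
  by (simp add: F_def)

lemma label_F: "k \<in> F \<Longrightarrow> \<rho> k \<in> R - {r0} \<and> \<kappa> k \<in> C - {c0}"
  using label_inner by (simp add: F_def)

lemma index_cases:
  obtains "k = r0" | "k \<in> R - {r0}" | "k = c0" | "k \<in> C - {c0}" | "k \<in> F"
  by (auto simp: F_def)

lemma col_vec_R: "k \<in> R \<Longrightarrow> col_vec t k a = of_bool (a = k)"
  by (simp add: col_vec_def)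

lemma col_vec_c0: "col_vec t c0 a = t^4 * of_bool (a = c0) + of_bool (a = r0) - t * of_bool (a \<in> R - {r0})"
  using c0 disjoint by (auto simp: col_vec_def)

lemma col_vec_C: "k \<in> C - {c0} \<Longrightarrow> col_vec t k a = t^3 * of_bool (a = k) + of_bool (a = r0)
    - t * of_nat (card {f \<in> F. \<rho> f = a \<and> \<kappa> f = k}) - t^2 * of_bool (a \<in> F \<and> \<kappa> a = k)"
  using disjoint by (auto simp: col_vec_def)

lemma col_vec_F: "k \<in> F \<Longrightarrow> col_vec t k a = t * of_bool (a = k) + of_bool (a = \<rho> k)"
  using c0 by (auto simp: col_vec_def F_def)

lemma sum_scale_of_bool:
  fixes x :: "'n \<Rightarrow> complex"
  shows "(\<Sum>b\<in>UNIV. c * of_bool (S b) * x b) = c * sum x {b. S b}"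
    and "(\<Sum>b\<in>UNIV. of_bool (S b) * x b) = sum x {b. S b}"
  by (simp_all add: mult.assoc sum_of_bool_mult_eq flip: sum_distrib_left)

lemma sum_row_vec_C: "k \<in> C \<Longrightarrow> (\<Sum>b\<in>UNIV. row_vec t k b * x b) = x k"
  by (simp add: row_vec_def sum_scale_of_bool)

lemma sum_row_vec_r0:
  "(\<Sum>b\<in>UNIV. row_vec t r0 b * x b) = t^4 * x r0 - t * sum x (C - {c0}) - x c0"
  using r0 by (simp add: row_vec_def R_iff sum_scale_of_bool left_diff_distrib sum_subtractf
      set_diff_eq del: of_bool_conj)

lemma sum_row_vec_R:
  "k \<in> R - {r0} \<Longrightarrow> (\<Sum>b\<in>UNIV. row_vec t k b * x b) = t^3 * x k + x c0 - t^2 * sum x {b \<in> F. \<rho> b = k}"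
  by (simp add: row_vec_def R_iff sum_scale_of_bool left_diff_distrib distrib_right sum.distrib sum_subtractf
      del: of_bool_conj)

lemma sum_row_vec_F:
  "k \<in> F \<Longrightarrow> (\<Sum>b\<in>UNIV. row_vec t k b * x b) = t * x k + x (\<kappa> k)"
proof -
  assume "k \<in> F"
  then have "k \<notin> C" "k \<noteq> r0" "k \<notin> R" using r0 by (auto simp: F_def)
  then show ?thesis by (simp add: row_vec_def sum_scale_of_bool distrib_right sum.distrib)
qed

lemma sum_row_vec:
  "(\<Sum>b\<in>UNIV. row_vec t k b * x b) =
    (if k \<in> C then x k
     else if k = r0 then t^4 * x r0 - t * sum x (C - {c0}) - x c0
     else if k \<in> R then t^3 * x k + x c0 - t^2 * sum x {b \<in> F. \<rho> b = k}
     else t * x k + x (\<kappa> k))"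
  using sum_row_vec_C[of k t x] sum_row_vec_r0[of t x] sum_row_vec_R[of k t x] sum_row_vec_F[of k t x]
  by (auto simp: F_def)

lemma row_vec_col_vec_R:
  assumes k': "k' \<in> R"
  shows "(\<Sum>b\<in>UNIV. row_vec t k b * col_vec t k' b) = (if k = k' then weight t k else 0)"
proof -
  have C: "sum (col_vec t k') (C - {c0}) = 0"
    using k' by (intro sum.neutral) (auto simp: col_vec_R R_iff)
  have F: "sum (col_vec t k') {b \<in> F. \<rho> b = k} = 0"
    using k' by (intro sum.neutral) (auto simp: col_vec_R R_iff)
  show ?thesis
    unfolding sum_row_vec C F weight_def
    using k' r0 c0 label_F[of k]
    by (cases k rule: index_cases)
      (auto simp: col_vec_R R_iff C_not_F eval_nat_numeral)
qed

lemma row_vec_col_vec_c0: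
  "(\<Sum>b\<in>UNIV. row_vec t k b * col_vec t c0 b) = (if k = c0 then weight t k else 0)"
proof -
  have C: "sum (col_vec t c0) (C - {c0}) = 0"
    using r0 c0 by (intro sum.neutral) (auto simp: col_vec_c0 R_iff)
  have F: "sum (col_vec t c0) {b \<in> F. \<rho> b = k} = 0"
    using r0 c0 by (intro sum.neutral) (auto simp: col_vec_c0 R_iff C_not_F)
  show ?thesis
    unfolding sum_row_vec C F weight_def
    using r0 c0 label_F[of k]
    by (cases k rule: index_cases)
      (auto simp: col_vec_c0 R_iff C_not_F eval_nat_numeral)
qed

text \<open>For \<open>k\<close> in \<open>R - {r0}\<close>, the counting term of
  \<open>col_vec\<close> and the terms at the labels of the cells (\<open>k\<close>,
  \<open>k'\<close>) contribute opposite multiples of \<open>t^4\<close>, each by the number of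
  these cells.\<close>

lemma row_vec_col_vec_C:
  assumes k': "k' \<in> C - {c0}"
  shows "(\<Sum>b\<in>UNIV. row_vec t k b * col_vec t k' b) = (if k = k' then weight t k else 0)"
proof -
  \<comment> \<open>Inner cells lie in rows of \<open>R - {r0}\<close>, so the count in
    \<open>col_vec\<close> is zero at all other indices.\<close>
  have no_cell: "{f \<in> F. \<rho> f = a \<and> \<kappa> f = k'} = {}" if "a \<notin> R - {r0}" for a
    using that label_F by auto
  have no_cell_card: "card {f \<in> F. \<rho> f = a \<and> \<kappa> f = k'} = 0" if "a \<in> C \<or> a \<in> F \<or> a = r0" for a
    using that by (subst no_cell) (auto simp: R_iff)
  have "sum (col_vec t k') (C - {c0}) = (\<Sum>b\<in>C - {c0}. if b = k' then t^3 else 0)"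
    using k' r0 no_cell by (intro sum.cong) (auto simp: col_vec_C R_iff C_not_F)
  then have C: "sum (col_vec t k') (C - {c0}) = t^3" using k' by simp
  have "sum (col_vec t k') {b \<in> F. \<rho> b = k} = (\<Sum>b\<in>{b \<in> F. \<rho> b = k}. - (t^2) * of_bool (\<kappa> b = k'))"
    using k' r0 no_cell by (intro sum.cong) (auto simp: col_vec_C R_iff C_not_F)
  also have "\<dots> = - (t^2) * of_nat (card {f \<in> F. \<rho> f = k \<and> \<kappa> f = k'})"
    by (simp only: sum_distrib_left[symmetric]) (simp add: sum_of_bool_eq Collect_conj_eq Int_assoc)
  finally have F: "sum (col_vec t k') {b \<in> F. \<rho> b = k} =
    - (t^2) * of_nat (card {f \<in> F. \<rho> f = k \<and> \<kappa> f = k'})" .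
  show ?thesis
    unfolding sum_row_vec C F weight_def
    using k' r0 c0 label_F[of k]
    by (cases k rule: index_cases)
      (auto simp: col_vec_C no_cell_card R_iff C_not_F eval_nat_numeral)
qed

text \<open>The row vector of \<open>\<rho> k'\<close> meets this column vector twice, with
  \<open>t^3\<close> at \<open>\<rho> k'\<close> and \<open>- t^2 * t\<close> at
  \<open>k'\<close>.\<close>

lemma row_vec_col_vec_F:
  assumes k': "k' \<in> F"
  shows "(\<Sum>b\<in>UNIV. row_vec t k b * col_vec t k' b) = (if k = k' then weight t k else 0)"
proof -
  note l = label_F[OF k']
  have C: "sum (col_vec t k') (C - {c0}) = 0"
    using k' l by (intro sum.neutral) (auto simp: col_vec_F R_iff C_not_F)
  have "sum (col_vec t k') {b \<in> F. \<rho> b = k} = (\<Sum>b\<in>{b \<in> F. \<rho> b = k}. if b = k' then t else 0)"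
    using k' l by (intro sum.cong) (auto simp: col_vec_F R_iff)
  then have F: "sum (col_vec t k') {b \<in> F. \<rho> b = k} = t * of_bool (\<rho> k' = k)"
    using k' by simp
  show ?thesis
    unfolding sum_row_vec C F weight_def
    using k' l r0 c0 label_F[of k]
    by (cases k rule: index_cases)
      (auto simp: col_vec_F R_iff C_not_F eval_nat_numeral)
qed

lemma row_vec_col_vec:
  "(\<Sum>b\<in>UNIV. row_vec t k b * col_vec t k' b) = (if k = k' then weight t k else 0)"
proof -
  consider "k' \<in> R" | "k' = c0" | "k' \<in> C - {c0}" | "k' \<in> F"
    by (auto simp: F_def)
  then show ?thesis
    by cases (simp_all only: row_vec_col_vec_R row_vec_col_vec_c0 row_vec_col_vec_C row_vec_col_vec_F)
qed

section \<open>The limit basis and its approximation\<close>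

definition basis :: "'n \<Rightarrow> complex^'n^'n" where
  "basis k = (if k = r0 then mat 1 else matrix_unit (\<rho> k) (\<kappa> k))"

lemma range_basis:
  "range basis = insert (mat 1) {matrix_unit (\<rho> k) (\<kappa> k) | k. k \<noteq> r0}"
proof -
  have "range basis = insert (basis r0) (basis ` {k. k \<noteq> r0})" by blast
  then show ?thesis by (simp add: basis_def setcompr_eq_image cong: image_cong_simp)
qed

text \<open>The identity, as the sum of all idempotents, replaces the one of \<open>r0\<close>: the
  rank-one matrix of \<open>r0\<close> would tend to minus the unit of the cell (\<open>r0\<close>,
  \<open>c0\<close>), which \<open>c0\<close> already labels.\<close>

definition deformed_basis :: "complex \<Rightarrow> 'n \<Rightarrow> complex^'n^'n" where
  "deformed_basis t k = (if k = r0 then mat 1 else (\<chi> i j. col_vec t k i * row_vec t k j))"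

lemma deformed_basis_limit:
  assumes "t \<longlonglongrightarrow> 0"
  shows "(\<lambda>n. deformed_basis (t n) k) \<longlonglongrightarrow> basis k"
proof (cases "k = r0")
  case True
  then show ?thesis by (simp add: deformed_basis_def basis_def)
next
  case False
  have "isCont (\<lambda>t. col_vec t k i) 0" for i
    unfolding col_vec_def by (cases "k \<in> R"; cases "k = c0"; cases "k \<in> C") simp_all
  then have col: "(\<lambda>n. col_vec (t n) k i) \<longlonglongrightarrow> col_vec 0 k i" for i
    using isCont_tendsto_compose[OF _ assms] by blast
  have "isCont (\<lambda>t. row_vec t k j) 0" for j
    unfolding row_vec_def by (cases "k \<in> R"; cases "k = r0"; cases "k \<in> C") simp_all
  then have row: "(\<lambda>n. row_vec (t n) k j) \<longlonglongrightarrow> row_vec 0 k j" for j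
    using isCont_tendsto_compose[OF _ assms] by blast
  have "(\<lambda>n. deformed_basis (t n) k) \<longlonglongrightarrow> (\<chi> i j. col_vec 0 k i * row_vec 0 k j)"
    using False by (simp add: deformed_basis_def tendsto_vec_lambda tendsto_mult col row)
  also have "(\<chi> i j. col_vec 0 k i * row_vec 0 k j) = matrix_unit (\<rho> k) (\<kappa> k)"
    using False disjoint r0 c0 label_row[of k] label_col[of k]
    by (auto simp: vec_eq_iff col_vec_def row_vec_def matrix_unit_def)
  finally show ?thesis using False by (simp add: basis_def)
qed

lemma labels_disjoint: "k \<noteq> r0 \<Longrightarrow> \<rho> k \<in> R \<and> \<kappa> k \<in> C"
  by (metis DiffD1 DiffI UnE c0 label_col label_inner label_row r0 singletonD)

lemma label_row_conv: "k \<in> R - {r0} \<longleftrightarrow> k \<noteq> r0 \<and> \<rho> k \<noteq> r0 \<and> \<kappa> k = c0"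
  by (metis Diff_iff Un_iff label_col label_inner label_row r0 singletonD singletonI)

lemma label_col_conv: "k \<in> C \<longleftrightarrow> k \<noteq> r0 \<and> \<rho> k = r0"
  by (metis Diff_iff Un_iff disjoint disjoint_iff label_col label_inner label_row r0 singletonD singletonI)

text \<open>The position of a cell shows whether its label is a row, a column or an inner index. In
  the hook the label is itself a coordinate of the position; elsewhere \<open>inj_inner\<close>
  applies.\<close>

lemma labels_inj:
  assumes "k \<noteq> r0" "k' \<noteq> r0" "\<rho> k = \<rho> k'" "\<kappa> k = \<kappa> k'"
  shows "k = k'"
proof -
  consider "k \<in> R - {r0}" "k' \<in> R - {r0}" | "k \<in> C" "k' \<in> C" | "k \<notin> R \<union> C" "k' \<notin> R \<union> C"
    using assms label_row_conv[of k] label_row_conv[of k'] label_col_conv[of k] label_col_conv[of k']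
      r0 by auto
  then show ?thesis
  proof cases
    case 1
    then show ?thesis using assms label_row by metis
  next
    case 2
    then show ?thesis using assms label_col by metis
  next
    case 3
    then show ?thesis using assms inj_onD[OF inj_inner, of k k'] by simp
  qed
qed

text \<open>Each coefficient is isolated by one entry: the identity by (\<open>r0\<close>,
  \<open>r0\<close>), which no cell occupies since \<open>R\<close> and \<open>C\<close> are
  disjoint, and every unit by its own off-diagonal cell.\<close>

lemma is_basis_family_basis: "is_basis_family basis (cmat.span (range basis))"
proof (rule is_basis_familyI)
  fix x assume sum0: "(\<Sum>k\<in>UNIV. x k *\<^sub>\<complex> basis k) = 0"
  have entry: "(\<Sum>k\<in>UNIV. x k * basis k $ i $ j) = 0" for i j
    using arg_cong[OF sum0, of "\<lambda>M. M $ i $ j"] by simp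
  have "(\<Sum>k\<in>UNIV. x k * basis k $ r0 $ r0) = (\<Sum>k\<in>UNIV. if k = r0 then x k else 0)"
    using labels_disjoint disjoint r0
    by (intro sum.cong) (auto simp: basis_def matrix_unit_def mat_def)
  then have "x r0 = 0" using entry by simp
  moreover have "x k = 0" if k: "k \<noteq> r0" for k
  proof -
    have ne: "\<rho> k \<noteq> \<kappa> k" by (metis labels_disjoint[OF k] disjoint disjoint_iff)
    have "basis k' $ \<rho> k $ \<kappa> k = of_bool (k' = k)" for k'
    proof (cases "k' = r0")
      case True
      then show ?thesis using ne k by (simp add: basis_def mat_def)
    next
      case False
      then have "\<rho> k = \<rho> k' \<and> \<kappa> k = \<kappa> k' \<longleftrightarrow> k' = k" using labels_inj[OF k False] by blast
      then show ?thesis using False by (simp add: basis_def matrix_unit_def)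
    qed
    then have "(\<Sum>k'\<in>UNIV. x k' * of_bool (k' = k)) = 0"
      using entry[of "\<rho> k" "\<kappa> k"] by simp
    then show ?thesis by simp
  qed
  ultimately show "x = (\<lambda>k. 0)" by metis
qed

lemma span_basis_degeneration:
  assumes "U = cmat.span (range basis)"
  shows "U \<in> Red"
    and "\<And>T :: complex^'n^'n^'n. range (flattening T) = U \<Longrightarrow> border_rank T = CARD('n)"
proof -
  define t :: "nat \<Rightarrow> complex" where "t n = inverse (of_nat (Suc n))" for n
  have t: "t n \<noteq> 0" for n by (simp add: t_def del: of_nat_Suc)
  have t0: "t \<longlonglongrightarrow> 0" unfolding t_def using tendsto_of_real[OF LIMSEQ_inverse_real_of_nat, where 'a = complex]
    by (simp del: of_nat_Suc)
  define P Q :: "nat \<Rightarrow> complex^'n^'n"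
    where "P n = (\<chi> i k. col_vec (t n) k i)"
      and "Q n = (\<chi> k j. row_vec (t n) k j / weight (t n) k)" for n
  \<comment> \<open>As \<open>Q n\<close> is normalized by the weights, the constant diagonal gives
    the identity, and the entry \<open>weight (t n) k\<close> undoes the normalization at
    \<open>k\<close>.\<close>
  define d where "d n k s = (if k = r0 then 1 else if s = k then weight (t n) k else 0)" for n k s
  have "Q n ** P n = mat 1" for n
    by (simp add: vec_eq_iff P_def Q_def matrix_matrix_mult_def mat_def row_vec_col_vec
        weight_nonzero t flip: sum_divide_distrib)
  then have inv: "P n ** Q n = mat 1" for n using matrix_left_right_inverse by blast
  have A: "deformed_basis (t n) k = P n ** diag (d n k) ** Q n" for n k
  proof (cases "k = r0")
    case True
    then have "diag (d n k) = mat 1" by (simp add: vec_eq_iff d_def mat_def)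
    then show ?thesis using True inv by (simp add: deformed_basis_def)
  next
    case False
    then show ?thesis
      by (simp add: vec_eq_iff conj_diag_nth deformed_basis_def d_def P_def Q_def
          weight_nonzero t if_distrib[of "\<lambda>x. x * _"] if_distrib[of "\<lambda>x. x / _"] cong: if_cong)
  qed
  have indep: "x = (\<lambda>k. 0)" if "\<And>s. (\<Sum>k\<in>UNIV. x k * d n k s) = 0" for n x
  proof -
    \<comment> \<open>The system is triangular: position \<open>r0\<close> involves only
      \<open>x r0\<close>, and any other \<open>s\<close> adds only \<open>x s\<close> with a
      nonzero weight.\<close>
    have split: "(\<Sum>k\<in>UNIV. x k * d n k s) = x r0 + (if s = r0 then 0 else x s * weight (t n) s)" for s
    proof -
      have "(\<Sum>k\<in>UNIV. x k * d n k s) = (\<Sum>k\<in>UNIV. (if k = r0 then x k else 0) +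
          (if k = s then if s = r0 then 0 else x s * weight (t n) s else 0))"
        by (rule sum.cong) (auto simp: d_def)
      then show ?thesis by (simp add: sum.distrib)
    qed
    have "x r0 = 0" using split[of r0] that[of r0] by simp
    then have "x s = 0" for s
      using split[of s] that[of s] weight_nonzero[OF t, of n s] by (cases "s = r0") auto
    then show ?thesis by blast
  qed
  have one: "mat 1 \<in> U"
    using assms cmat.span_base[of "basis r0" "range basis"] by (simp add: basis_def)
  note basis = is_basis_family_basis[folded assms]
  show "U \<in> Red"
    by (rule limit_in_Red[OF inv A indep basis deformed_basis_limit[OF t0] one])
  show "border_rank T = CARD('n)" if "range (flattening T) = U" for T :: "complex^'n^'n^'n"
    by (rule limit_border_rank[OF inv A indep basis deformed_basis_limit[OF t0] one that])
qed

end


section \<open>Partitions\<close>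

text \<open>The hook has \<open>l ! 0 + length l - 1\<close> cells, its corner being shared. For
  \<open>n\<close> one less than the matrix size, the right-hand side is the number of
  indices.\<close>

lemma card_inner_cells:
  assumes l: "is_partition l n" and ne: "l \<noteq> []"
  shows "card (SIGMA i:{2..length l}. {2..l ! (i - 1)}) + l ! 0 + length l = Suc n"
proof -
  have pos: "l ! (i - 1) \<ge> 1" if "i \<in> {2..length l}" for i
    using l that nth_mem[of "i - 1" l] by (auto simp: is_partition_def Suc_le_eq)
  \<comment> \<open>Adding 1 per row restores the cell of the first column; positivity of the parts
    makes the truncated subtraction exact.\<close>
  have "card (SIGMA i:{2..length l}. {2..l ! (i - 1)}) + (length l - 1) =
      (\<Sum>i\<in>{2..length l}. (l ! (i - 1) - 1) + 1)"
    by (subst sum.distrib) simp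
  also have "\<dots> = (\<Sum>i\<in>{2..length l}. l ! (i - 1))"
    using pos by (intro sum.cong refl le_add_diff_inverse2)
  also have "\<dots> + l ! 0 = (\<Sum>i\<in>{1..length l}. l ! (i - 1))"
    using ne by (subst sum.atLeast_Suc_atMost[of 1]) (auto simp: numeral_2_eq_2 Suc_le_eq)
  also have "\<dots> = sum_list l"
    by (simp add: sum_list_sum_nth,
        rule sum.reindex_bij_witness[of _ Suc "\<lambda>i. i - 1"]) auto
  also have "\<dots> = n" using l by (simp add: is_partition_def)
  finally show ?thesis using ne by (cases l) simp_all
qed

lemma partition_part_le_first:
  assumes "is_partition l n" "i \<in> {1..length l}"
  shows "l ! (i - 1) \<in> {1..l ! 0}"
proof -
  have "l ! (i - 1) \<le> l ! 0"
    using assms sorted_wrt_nth_less[of "(\<ge>)" l 0 "i - 1"]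
    by (cases "i = 1") (auto simp: is_partition_def)
  moreover have "l ! (i - 1) > 0"
    using assms nth_mem[of "i - 1" l] by (auto simp: is_partition_def)
  ultimately show ?thesis by simp
qed

lemma partition_labelling:
  fixes idx :: "nat \<Rightarrow> 'n::finite" and l :: "nat list"
  assumes numbering: "bij_betw idx {1..CARD('n)} UNIV"
    and partition: "is_partition l (CARD('n) - 1)" and ne: "l \<noteq> []"
  obtains R C :: "'n set" and r0 c0 :: 'n and \<rho> \<kappa> :: "'n \<Rightarrow> 'n"
  where "cell_labelling R C r0 c0 \<rho> \<kappa>"
    and "U_partition idx l = cmat.span (range (cell_labelling.basis r0 \<rho> \<kappa>))"
proof -
  define m where "m = CARD('n)"
  have m: "m > 0" by (simp add: m_def)
  define I where "I = (SIGMA i:{2..length l}. {2..l ! (i - 1)})"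
  have count: "card I + l ! 0 + length l = m"
    using card_inner_cells[OF partition ne] m by (simp add: I_def m_def)
  \<comment> \<open>Columns are numbered from the right, which undoes the reflection of the
    diagram.\<close>
  define e where "e j = idx (m + 1 - j)" for j
  have inj: "inj_on idx {1..m}" using numbering by (simp add: bij_betw_def m_def)
  have idx_eq: "idx i = idx j \<longleftrightarrow> i = j" if "i \<in> {1..m}" "j \<in> {1..m}" for i j
    using inj that by (auto dest: inj_onD)
  have e_eq: "e i = e j \<longleftrightarrow> i = j" if "i \<in> {1..m}" "j \<in> {1..m}" for i j
    unfolding e_def using that by (subst idx_eq) auto
  have len: "1 \<le> length l" using ne by (simp add: Suc_le_eq)
  have first: "1 \<le> l ! 0" using partition_part_le_first[OF partition, of 1] len by simp
  define R C where "R = idx ` {1..length l}" and "C = e ` {1..l ! 0}"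
  \<comment> \<open>By \<open>count\<close>, \<open>length l + l ! 0\<close> is at most
    \<open>m\<close>, hence \<open>i < m + 1 - j\<close>.\<close>
  have disj: "idx i \<noteq> e j" if "i \<in> {1..length l}" "j \<in> {1..l ! 0}" for i j
    unfolding e_def using that count by (subst idx_eq) auto
  have "card R = length l" unfolding R_def
    using count by (subst card_image) (auto intro: inj_on_subset[OF inj])
  moreover have "card C = l ! 0" unfolding C_def
    using count e_eq by (subst card_image) (auto simp: inj_on_def)
  moreover have "R \<inter> C = {}" using disj by (auto simp: R_def C_def)
  ultimately have "card (- (R \<union> C)) = card I"
    using count by (simp add: Compl_eq_Diff_UNIV card_Diff_subset card_Un_disjoint m_def)
  moreover have "finite I" by (simp add: I_def)
  \<comment> \<open>The equal cardinalities allow each inner cell an index of its own, outside the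
    rows and columns of the diagram.\<close>
  ultimately obtain \<phi> where \<phi>: "bij_betw \<phi> (- (R \<union> C)) I"
    using finite_same_card_bij[of "- (R \<union> C)" I] by auto
  define \<rho> where "\<rho> k = (if k \<in> R then k else if k \<in> C then idx 1 else idx (fst (\<phi> k)))" for k
  define \<kappa> where "\<kappa> k = (if k \<in> R then e 1 else if k \<in> C then k else e (snd (\<phi> k)))" for k
  have I: "i \<in> {2..length l} \<and> j \<in> {2..l ! 0} \<and> j \<le> l ! (i - 1)" if "(i, j) \<in> I" for i j
    using that partition_part_le_first[OF partition, of i] by (auto simp: I_def)
  have \<phi>_in: "\<phi> k \<in> I" if "k \<notin> R \<union> C" for k
    using that bij_betwE[OF \<phi>] by auto
  have inner: "\<exists>i j. \<phi> k = (i, j) \<and> (i, j) \<in> I \<and> \<rho> k = idx i \<and> \<kappa> k = e j" if "k \<notin> R \<union> C" for k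
    using \<phi>_in[OF that] that by (cases "\<phi> k") (auto simp: \<rho>_def \<kappa>_def)
  interpret cell_labelling R C "idx 1" "e 1" \<rho> \<kappa>
  proof
    show "R \<inter> C = {}" by fact
    show "idx 1 \<in> R" "e 1 \<in> C" using len first by (auto simp: R_def C_def)
    show "\<rho> k = k \<and> \<kappa> k = e 1" if "k \<in> R - {idx 1}" for k
      using that by (simp add: \<rho>_def \<kappa>_def)
    show "\<rho> k = idx 1 \<and> \<kappa> k = k" if "k \<in> C" for k
      using that \<open>R \<inter> C = {}\<close> by (auto simp: \<rho>_def \<kappa>_def)
    show "\<rho> k \<in> R - {idx 1} \<and> \<kappa> k \<in> C - {e 1}" if "k \<notin> R \<union> C" for k
    proof -
      obtain i j where ij: "(i, j) \<in> I" "\<rho> k = idx i" "\<kappa> k = e j" using inner \<open>k \<notin> R \<union> C\<close> by blast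
      have "idx i \<noteq> idx 1" "e j \<noteq> e 1" using I[OF ij(1)] count by (auto simp: idx_eq e_eq)
      then show ?thesis using I[OF ij(1)] ij by (auto simp: R_def C_def)
    qed
    show "inj_on (\<lambda>k. (\<rho> k, \<kappa> k)) (- (R \<union> C))"
    proof (rule inj_onI)
      fix k k' assume k: "k \<in> - (R \<union> C)" "k' \<in> - (R \<union> C)" "(\<rho> k, \<kappa> k) = (\<rho> k', \<kappa> k')"
      obtain i j where ij: "\<phi> k = (i, j)" "(i, j) \<in> I" "\<rho> k = idx i" "\<kappa> k = e j"
        using inner k(1) by blast
      obtain i' j' where ij': "\<phi> k' = (i', j')" "(i', j') \<in> I" "\<rho> k' = idx i'" "\<kappa> k' = e j'"
        using inner k(2) by blast
      have "i = i'" "j = j'"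
        using k(3) ij ij' I[OF ij(2)] I[OF ij'(2)] count by (auto simp: idx_eq e_eq)
      then show "k = k'" using k(1,2) ij(1) ij'(1) inj_onD[OF bij_betw_imp_inj_on[OF \<phi>]] by simp
    qed
  qed
  have cells: "{(\<rho> k, \<kappa> k) | k. k \<noteq> idx 1} =
      {(idx i, e j) | i j. i \<in> {1..length l} \<and> j \<in> {1..l ! (i - 1)}}" (is "?L = ?R")
  proof
    show "?L \<subseteq> ?R"
    proof safe
      fix k assume k: "k \<noteq> idx 1"
      consider "k \<in> R" | "k \<in> C" | "k \<notin> R \<union> C" by blast
      then show "\<exists>i j. (\<rho> k, \<kappa> k) = (idx i, e j) \<and> i \<in> {1..length l} \<and> j \<in> {1..l ! (i - 1)}"
      proof cases
        case 1
        then obtain i where i: "k = idx i" "i \<in> {1..length l}" by (auto simp: R_def)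
        then have "1 \<in> {1..l ! (i - 1)}" using partition_part_le_first[OF partition i(2)] by simp
        then show ?thesis using label_row[of k] 1 k i by (intro exI[of _ i] exI[of _ 1]) simp
      next
        case 2
        then obtain j where "k = e j" "j \<in> {1..l ! 0}" by (auto simp: C_def)
        then show ?thesis using label_col[OF 2] len by (intro exI[of _ 1] exI[of _ j]) simp
      next
        case 3
        then obtain i j where ij: "(i, j) \<in> I" "\<rho> k = idx i" "\<kappa> k = e j" using inner by blast
        then show ?thesis using I[OF ij(1)] by (intro exI[of _ i] exI[of _ j]) simp
      qed
    qed
    show "?R \<subseteq> ?L"
    proof safe
      fix i j assume i: "i \<in> {1..length l}" and j: "j \<in> {1..l ! (i - 1)}"
      \<comment> \<open>First row, rest of the first column, and inner cells: the labels are a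
        column, a row and a preimage under \<open>\<phi>\<close>.\<close>
      consider "i = 1" | "i \<noteq> 1" "j = 1" | "i \<noteq> 1" "j \<noteq> 1" by blast
      then show "\<exists>k. (idx i, e j) = (\<rho> k, \<kappa> k) \<and> k \<noteq> idx 1"
      proof cases
        case 1
        then have "e j \<in> C" using j by (auto simp: C_def)
        then show ?thesis using label_col[of "e j"] 1 disj[of 1 j] len j by (intro exI[of _ "e j"]) auto
      next
        case 2
        have "idx i \<in> R - {idx 1}" using i 2 count by (auto simp: R_def idx_eq)
        then show ?thesis using label_row[of "idx i"] 2 by (intro exI[of _ "idx i"]) auto
      next
        case 3
        then have "(i, j) \<in> I" using i j by (auto simp: I_def)
        then obtain k where k: "k \<notin> R \<union> C" "\<phi> k = (i, j)"
          using \<phi> by (auto simp: bij_betw_def image_iff)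
        then have "\<rho> k = idx i" "\<kappa> k = e j" by (auto simp: \<rho>_def \<kappa>_def)
        moreover have "k \<noteq> idx 1" using k r0 by auto
        ultimately show ?thesis by (intro exI[of _ k]) simp
      qed
    qed
  qed
  have "range basis = insert (mat 1) ((\<lambda>(p, q). matrix_unit p q) ` ?L)"
    using range_basis by (simp only: setcompr_eq_image image_image prod.case)
  also have "\<dots> = insert (mat 1) {matrix_unit (idx i) (e j) | i j. i \<in> {1..length l} \<and> j \<in> {1..l ! (i - 1)}}"
    unfolding cells by (auto simp: image_iff)
  finally have "U_partition idx l = cmat.span (range basis)"
    by (simp add: U_partition_def e_def m_def)
  then show thesis using that cell_labelling_axioms by blast
qed

theorem proposition6p4:
  fixes idx :: "nat \<Rightarrow> 'n::finite" and l :: "nat list"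
  assumes numbering: "bij_betw idx {1..CARD('n)} UNIV"
    and partition: "is_partition l (CARD('n) - 1)"
  shows "U_partition idx l \<in> Red
    \<and> (\<exists>T :: complex^'n^'n^'n. range (flattening T) = U_partition idx l)
    \<and> (\<forall>T :: complex^'n^'n^'n.
          range (flattening T) = U_partition idx l \<longrightarrow> border_rank T = CARD('n))"
proof (cases "l = []")
  case True
  \<comment> \<open>The empty diagram offers no \<open>r0\<close> and \<open>c0\<close>. The
    matrices are 1 by 1, and the span of the identity is already diagonalizable, so constant
    sequences serve as the degeneration.\<close>
  then have card: "CARD('n) = 1"
    using partition zero_less_card_finite[where 'a='n] by (simp add: is_partition_def le_Suc_eq)
  then obtain r :: 'n where UNIV: "UNIV = {r}" by (auto simp: card_1_singleton_iff)
  have r: "i = r" for i :: 'n using UNIV by blast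
  define B :: "'n \<Rightarrow> complex^'n^'n" where "B = (\<lambda>_. mat 1)"
  have mat1: "mat 1 = (diag (\<lambda>_. 1) :: complex^'n^'n)" by (simp add: vec_eq_iff mat_def)
  have range: "range B = {mat 1}" by (auto simp: B_def)
  have U: "U_partition idx l = cmat.span (range B)" using True by (simp add: U_partition_def range)
  have A: "B k = mat 1 ** diag (\<lambda>_. 1) ** mat 1" for k by (simp add: B_def flip: mat1)
  have indep: "x = (\<lambda>k. 0)" if "\<And>s :: 'n. (\<Sum>k\<in>UNIV. x k * 1) = 0" for x :: "'n \<Rightarrow> complex"
  proof
    show "x k = 0" for k using that r[of k] by (simp add: UNIV)
  qed
  have one: "mat 1 \<in> U_partition idx l" by (simp add: U range cmat.span_base)
  have basis: "is_basis_family B (U_partition idx l)"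
    unfolding U by (rule conj_diag_basis_family[where d = "\<lambda>_ _. 1", OF _ A indep]) auto
  have "range (flattening ((\<chi> k. B k) :: complex^'n^'n^'n)) = U_partition idx l"
    by (simp add: U range_flattening)
  then show ?thesis
    using limit_in_Red[where A="\<lambda>_. B" and P="\<lambda>_. mat 1" and Q="\<lambda>_. mat 1" and d="\<lambda>_ _ _. 1",
        OF _ A indep basis _ one]
      limit_border_rank[where A="\<lambda>_. B" and P="\<lambda>_. mat 1" and Q="\<lambda>_. mat 1" and d="\<lambda>_ _ _. 1",
        OF _ A indep basis _ one] by auto
next
  case False
  from partition_labelling[OF numbering partition False]
  obtain R C :: "'n set" and r0 c0 \<rho> \<kappa> where lab: "cell_labelling R C r0 c0 \<rho> \<kappa>"
    and U: "U_partition idx l = cmat.span (range (cell_labelling.basis r0 \<rho> \<kappa>))" .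
  have "range (flattening ((\<chi> k. cell_labelling.basis r0 \<rho> \<kappa> k) :: complex^'n^'n^'n)) = U_partition idx l"
    by (simp add: U range_flattening)
  then show ?thesis
    using cell_labelling.span_basis_degeneration[OF lab U] by blast
qed

end
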